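(* Let $U\subset\mathbb{R}^n$ be a simply connected domain equipped with a Finsler structure. Suppose that the corresponding Finsler reflection law is projective. Then the Finsler structure is Riemannian, i.e. for every $x\in U$ the Finsler unit sphere $I_x\subset T_xU$ is an ellipsoid.
   Context: A Finsler structure on a manifold $M$ is a family of smooth strictly convex closed hypersurfaces $I_x\subset T_xM$ (indicatrices, or unit spheres), centrally symmetric with respect to zero; the Finsler norm on $T_xM$ is the norm with unit sphere $I_x$. Finsler reflection law. The Legendre transform $D:I_x\to T_x^*M\setminus\{0\}$ sends $v\in I_x$ to the covector $w=D(v)$ with $w(v)=1$ and $\ker w$ parallel to the tangent hyperplane $T_vI_x$. For a codimension one vector subspace $H\subset T_xM$, the Finsler reflection with respect to $H$ is the involution $I_x\to I_x$ fixing the points of $I_x\cap H$ and sending each $u\in I_x\setminus H$ to the unique $v\in I_x$, $v\neq u$, such that $D(u)-D(v)$ vanishes on $H$ (then $u,v$ lie on different sides of $H$). Equivalently, the tangent hyperplanes to $I_x$ at $u$ and at $v$ and the hyperplane $H$ are concurrent (either parallel or intersecting in a common codimension two affine subspace). Identifying vectors of $I_x$ with oriented lines through the origin of $T_xM$, it acts on oriented directions. The Finsler reflection law is projective if for every $x\in M$ and every codimension one vector subspace $H\subset T_xM$ there is a line $\mathcal N\subset T_xM$ through $0$ transversal to $H$ such that the Finsler reflection with respect to $H$ acts on oriented directions as the linear involution of $T_xM$ that is the identity on $H$ and $-\mathrm{id}$ on $\mathcal N$. *)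

theory Defs
  imports "HOL-Analysis.Analysis"
begin

text \<open>
  Differentiability of class C^k, meant for an open set \<open>V\<close> of a finite-dimensional space:
  all iterated directional derivatives up to order k exist, are differentiable below order k, and
  are continuous.
\<close>

primrec Ck_on :: "nat \<Rightarrow> ('a::euclidean_space \<Rightarrow> real) \<Rightarrow> 'a set \<Rightarrow> bool" where
  "Ck_on 0 f V \<longleftrightarrow> continuous_on V f"
| "Ck_on (Suc k) f V \<longleftrightarrow>
     (\<forall>y\<in>V. f differentiable (at y)) \<and> (\<forall>d. Ck_on k (\<lambda>y. frechet_derivative f (at y) d) V)"

definition smooth_on :: "('a::euclidean_space \<Rightarrow> real) \<Rightarrow> 'a set \<Rightarrow> bool" where
  "smooth_on f V \<longleftrightarrow> (\<forall>k. Ck_on k f V)"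

definition smooth_hypersurface :: "'a::euclidean_space set \<Rightarrow> bool" where
  "smooth_hypersurface S \<longleftrightarrow>
     (\<forall>p\<in>S. \<exists>V f. open V \<and> p \<in> V \<and> smooth_on f V \<and>
        frechet_derivative f (at p) \<noteq> (\<lambda>_. 0) \<and> S \<inter> V = {y \<in> V. f y = 0})"

text \<open>
  Strict convexity is understood in the weak sense (no line segments in the hypersurface); the
  second fundamental form may degenerate.
\<close>

definition strictly_convex_closed_hypersurface :: "'a::euclidean_space set \<Rightarrow> bool" where
  "strictly_convex_closed_hypersurface S \<longleftrightarrow>
     (\<exists>K. compact K \<and> convex K \<and> interior K \<noteq> {} \<and> S = frontier K) \<and>
     (\<forall>a\<in>S. \<forall>b\<in>S. a \<noteq> b \<longrightarrow> open_segment a b \<inter> S = {})"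

definition indicatrix :: "'a::euclidean_space set \<Rightarrow> bool" where
  "indicatrix S \<longleftrightarrow>
     smooth_hypersurface S \<and> strictly_convex_closed_hypersurface S \<and> (\<forall>v\<in>S. - v \<in> S)"

text \<open>
  Every tangent space of an open set \<open>U\<close> is identified with the ambient vector space. No regularity
  of \<open>I x\<close> in the base point \<open>x\<close> is demanded.
\<close>

definition finsler_structure :: "'a::euclidean_space set \<Rightarrow> ('a \<Rightarrow> 'a set) \<Rightarrow> bool" where
  "finsler_structure U I \<longleftrightarrow> (\<forall>x\<in>U. indicatrix (I x))"

text \<open>
  The linear tangent space (the direction of the affine tangent hyperplane at \<open>p\<close>), as the set of
  velocities of curves in \<open>S\<close> through \<open>p\<close>. Only differentiability at time 0 is asked of the curves,
  which for smooth hypersurfaces gives the same velocities as smooth curves.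
\<close>

definition tangent_space :: "'a::euclidean_space set \<Rightarrow> 'a \<Rightarrow> 'a set" where
  "tangent_space S p =
     {d. \<exists>\<gamma> e. e > 0 \<and> (\<forall>t::real. \<bar>t\<bar> < e \<longrightarrow> \<gamma> t \<in> S) \<and> \<gamma> 0 = p \<and>
           (\<gamma> has_vector_derivative d) (at 0)}"

definition legendre :: "'a::euclidean_space set \<Rightarrow> 'a \<Rightarrow> ('a \<Rightarrow>\<^sub>L real)" where
  "legendre S v =
     (THE w. blinfun_apply w v = 1 \<and> {d. blinfun_apply w d = 0} = tangent_space S v)"

definition codim_one_subspace :: "'a::euclidean_space set \<Rightarrow> bool" where
  "codim_one_subspace H \<longleftrightarrow> subspace H \<and> dim H + 1 = DIM('a)"

definition finsler_reflection :: "'a::euclidean_space set \<Rightarrow> 'a set \<Rightarrow> 'a \<Rightarrow> 'a" where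
  "finsler_reflection S H u =
     (if u \<in> H then u
      else (THE v. v \<in> S \<and> v \<noteq> u \<and>
              (\<forall>h\<in>H. blinfun_apply (legendre S u - legendre S v) h = 0)))"

text \<open>
  An oriented direction is an open ray from the origin, so two nonzero vectors define the same one
  iff they are positive multiples of each other. Since \<open>H\<close> and \<open>N\<close> are complementary, the linear map
  \<open>s\<close> below is unique.
\<close>

definition projective_reflection_law ::
    "'a::euclidean_space set \<Rightarrow> ('a \<Rightarrow> 'a set) \<Rightarrow> bool" where
  "projective_reflection_law U I \<longleftrightarrow>
     (\<forall>x\<in>U. \<forall>H. codim_one_subspace H \<longrightarrow>
        (\<exists>N. subspace N \<and> dim N = 1 \<and> H \<inter> N = {0} \<and>
          (\<exists>s. linear s \<and> (\<forall>h\<in>H. s h = h) \<and> (\<forall>m\<in>N. s m = - m) \<and>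
             (\<forall>u\<in>I x. \<exists>c>0. finsler_reflection (I x) H u = c *\<^sub>R s u))))"

text \<open>Ellipsoids centred at the origin, i.e. unit spheres of Euclidean inner products.\<close>

definition ellipsoid :: "'a::euclidean_space set \<Rightarrow> bool" where
  "ellipsoid S \<longleftrightarrow>
     (\<exists>g. bilinear g \<and> (\<forall>v w. g v w = g w v) \<and> (\<forall>v. v \<noteq> 0 \<longrightarrow> g v v > 0) \<and>
          S = {v. g v v = (1::real)})"

definition riemannian :: "'a::euclidean_space set \<Rightarrow> ('a \<Rightarrow> 'a set) \<Rightarrow> bool" where
  "riemannian U I \<longleftrightarrow> (\<forall>x\<in>U. ellipsoid (I x))"

end

theory Submission
  imports Defs
begin

text \<open>
  The statement is pointwise in \<open>x\<close>. Let \<open>F\<close> be the norm with unit sphere \<open>I x\<close>, and let \<open>s\<close> be the linear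
  involution attached to a hyperplane \<open>H\<close> and a transversal line \<open>N\<close>. Since the Legendre transform is
  the differential of \<open>F\<close>, the reflection law says that \<open>F - F \<circ> s\<close> has zero derivative along \<open>H\<close>; it
  vanishes on \<open>N\<close> because \<open>F\<close> is even, hence \<open>F \<circ> s = F\<close>. So the unit ball is preserved by a linear
  reflection in every hyperplane. Its covariance operator \<open>M\<close> is preserved as well, and therefore these
  are exactly the orthogonal reflections of the inner product defined by the inverse of \<open>M\<close>. They act
  transitively on its spheres, so \<open>F\<close> is a multiple of the corresponding Euclidean norm.
\<close>

section \<open>The gauge of a symmetric convex body\<close>

locale symmetric_body =
  fixes K :: "'a::euclidean_space set"
  assumes compact_body: "compact K"
    and convex_body: "convex K"
    and zero_interior: "0 \<in> interior K"
    and minus_body: "x \<in> K \<Longrightarrow> - x \<in> K"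
begin

definition minkowski :: "'a \<Rightarrow> real" where
  "minkowski x = Inf {r. 0 < r \<and> x /\<^sub>R r \<in> K}"

lemma ball_subset_body: obtains e where "e > 0" "ball 0 e \<subseteq> K"
  using zero_interior mem_interior by blast

lemma scale_in_body: "\<lbrakk>x \<in> K; 0 \<le> c; c \<le> 1\<rbrakk> \<Longrightarrow> c *\<^sub>R x \<in> K"
  using convexD_alt[OF convex_body, of 0 x c] zero_interior interior_subset by auto

lemma minkowski_set_nonempty: "{r. 0 < r \<and> x /\<^sub>R r \<in> K} \<noteq> {}"
proof -
  obtain e where e: "e > 0" "ball 0 e \<subseteq> K"
    by (rule ball_subset_body)
  define r where "r = (norm x + 1) / e"
  have "r > 0"
    using e(1) by (simp add: r_def add_nonneg_pos)
  moreover have "norm x < r * e"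
    using e(1) by (simp add: r_def)
  ultimately have "x /\<^sub>R r \<in> ball 0 e"
    by (simp add: field_simps)
  then show ?thesis
    using e(2) \<open>r > 0\<close> by blast
qed

lemma minkowski_set_bdd: "bdd_below {r. 0 < r \<and> x /\<^sub>R r \<in> K}"
  by (rule bdd_belowI[of _ 0]) auto

text \<open>The infimum is attained because \<open>K\<close> is closed, and an admissible radius
  stays admissible when enlarged because \<open>K\<close> is convex and contains 0. Later proofs
  compare the gauge with positive radii through this equivalence.\<close>

lemma minkowski_le_iff:
  assumes "r > 0"
  shows "minkowski x \<le> r \<longleftrightarrow> x /\<^sub>R r \<in> K"
proof
  assume "x /\<^sub>R r \<in> K"
  then show "minkowski x \<le> r"
    unfolding minkowski_def using assms minkowski_set_bdd by (intro cInf_lower) auto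
next
  assume le: "minkowski x \<le> r"
  have in_K: "x /\<^sub>R r' \<in> K" if "r' > r" for r'
  proof -
    have "Inf {r. 0 < r \<and> x /\<^sub>R r \<in> K} < r'"
      using le that by (simp add: minkowski_def)
    then obtain q where q: "0 < q" "x /\<^sub>R q \<in> K" "q < r'"
      using cInf_lessD[OF minkowski_set_nonempty] by blast
    then have "(q / r') *\<^sub>R (x /\<^sub>R q) \<in> K"
      by (intro scale_in_body[OF q(2)]) auto
    then show ?thesis
      using q by (simp add: field_simps)
  qed
  have "((\<lambda>r'. x /\<^sub>R r') \<longlongrightarrow> x /\<^sub>R r) (at_right r)"
    using assms by (intro tendsto_intros) auto
  moreover have "eventually (\<lambda>r'. x /\<^sub>R r' \<in> K) (at_right r)"
    by (rule eventually_mono[OF eventually_at_right_less]) (rule in_K)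
  ultimately show "x /\<^sub>R r \<in> K"
    using Lim_in_closed_set[OF compact_imp_closed[OF compact_body]] by fastforce
qed

lemma minkowski_nonneg: "minkowski x \<ge> 0"
  unfolding minkowski_def using minkowski_set_nonempty by (intro cInf_greatest) auto

text \<open>Testing positive radii is enough since both values are nonnegative, and
  \<open>minkowski_le_iff\<close> speaks about exactly those radii.\<close>

lemma minkowski_eqI:
  assumes "a \<ge> 0" "\<And>r. r > 0 \<Longrightarrow> minkowski x \<le> r \<longleftrightarrow> a \<le> r"
  shows "minkowski x = a"
proof (rule antisym)
  show "minkowski x \<le> a"
  proof (rule dense_ge)
    fix r assume "a < r"
    then show "minkowski x \<le> r"
      using assms(1) assms(2)[of r] by linarith
  qed
  show "a \<le> minkowski x"
  proof (rule dense_ge)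
    fix r assume "minkowski x < r"
    then show "a \<le> r"
      using minkowski_nonneg[of x] assms(2)[of r] by linarith
  qed
qed

lemma minkowski_zero [simp]: "minkowski 0 = 0"
  using zero_interior interior_subset by (intro minkowski_eqI) (auto simp: minkowski_le_iff)

lemma minkowski_scale: "c \<ge> 0 \<Longrightarrow> minkowski (c *\<^sub>R x) = c * minkowski x"
proof (cases "c = 0")
  case False
  assume "c \<ge> 0"
  with False have "c > 0"
    by simp
  show ?thesis
  proof (intro minkowski_eqI)
    fix r :: real
    assume "r > 0"
    then have "minkowski (c *\<^sub>R x) \<le> r \<longleftrightarrow> (c *\<^sub>R x) /\<^sub>R r \<in> K"
      by (rule minkowski_le_iff)
    also have "(c *\<^sub>R x) /\<^sub>R r = x /\<^sub>R (r / c)"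
      by (simp add: divide_inverse mult.commute)
    also have "x /\<^sub>R (r / c) \<in> K \<longleftrightarrow> minkowski x \<le> r / c"
      using \<open>r > 0\<close> \<open>c > 0\<close> by (intro minkowski_le_iff[symmetric] divide_pos_pos)
    finally have "minkowski (c *\<^sub>R x) \<le> r \<longleftrightarrow> minkowski x \<le> r / c" .
    then show "minkowski (c *\<^sub>R x) \<le> r \<longleftrightarrow> c * minkowski x \<le> r"
      using \<open>c > 0\<close> by (simp add: field_simps)
  qed (use \<open>c > 0\<close> minkowski_nonneg in simp)
qed simp

lemma minkowski_minus: "minkowski (- x) = minkowski x"
  using minus_body[of "x /\<^sub>R r" for r] minus_body[of "- x /\<^sub>R r" for r]
  by (intro minkowski_eqI minkowski_nonneg) (auto simp: minkowski_le_iff)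

lemma body_iff: "x \<in> K \<longleftrightarrow> minkowski x \<le> 1"
  by (simp add: minkowski_le_iff)

text \<open>Boundedness of \<open>K\<close>: a nonzero \<open>x\<close> with gauge 0 would place its
  whole ray in \<open>K\<close>.\<close>

lemma minkowski_pos: "x \<noteq> 0 \<Longrightarrow> minkowski x > 0"
proof (rule ccontr)
  assume x: "x \<noteq> 0" "\<not> minkowski x > 0"
  then have "minkowski x = 0"
    using minkowski_nonneg[of x] by simp
  obtain B where B: "B > 0" "\<And>y. y \<in> K \<Longrightarrow> norm y \<le> B"
    using compact_imp_bounded[OF compact_body] bounded_pos by blast
  define c where "c = (B + 1) / norm x"
  have "c *\<^sub>R x \<in> K"
    using minkowski_scale[of c x] \<open>minkowski x = 0\<close> B(1) by (simp add: body_iff c_def)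
  from B(2)[OF this] show False
    using x(1) B(1) by (simp add: c_def)
qed

text \<open>Convexity applied to the normalised vectors, with weights proportional to their
  gauges.\<close>

lemma minkowski_triangle: "minkowski (x + y) \<le> minkowski x + minkowski y"
proof (cases "x = 0 \<or> y = 0")
  case False
  define a b where "a = minkowski x" and "b = minkowski y"
  have ab: "a > 0" "b > 0"
    using False minkowski_pos by (auto simp: a_def b_def)
  have "x /\<^sub>R a \<in> K" "y /\<^sub>R b \<in> K"
    using ab by (simp_all add: a_def b_def flip: minkowski_le_iff)
  then have "(a / (a + b)) *\<^sub>R (x /\<^sub>R a) + (b / (a + b)) *\<^sub>R (y /\<^sub>R b) \<in> K"
    using ab by (intro convexD[OF convex_body]) (auto simp flip: add_divide_distrib)
  then have "(x + y) /\<^sub>R (a + b) \<in> K"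
    using ab by (simp add: scaleR_add_right field_simps)
  then show ?thesis
    using ab by (simp add: a_def b_def flip: minkowski_le_iff)
qed auto

lemma minkowski_bound: "\<exists>C>0. \<forall>x. minkowski x \<le> C * norm x"
proof -
  obtain e where e: "e > 0" "ball 0 e \<subseteq> K"
    by (rule ball_subset_body)
  have "minkowski x \<le> (2 / e) * norm x" for x
  proof (cases "x = 0")
    case False
    then have "x /\<^sub>R ((2 / e) * norm x) \<in> ball 0 e"
      using e(1) by simp
    then show ?thesis
      using e False by (subst minkowski_le_iff) auto
  qed simp
  then show ?thesis
    using e(1) by (intro exI[of _ "2 / e"]) simp
qed

lemma minkowski_lipschitz: "\<exists>C>0. \<forall>x y. \<bar>minkowski x - minkowski y\<bar> \<le> C * norm (x - y)"
proof -
  obtain C where C: "C > 0" "\<And>x. minkowski x \<le> C * norm x"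
    using minkowski_bound by blast
  have *: "minkowski x - minkowski y \<le> C * norm (x - y)" for x y
    using minkowski_triangle[of y "x - y"] C(2)[of "x - y"] by simp
  have "\<bar>minkowski x - minkowski y\<bar> \<le> C * norm (x - y)" for x y
    using *[of x y] *[of y x] by (simp add: norm_minus_commute abs_le_iff)
  then show ?thesis
    using C(1) by blast
qed

lemma isCont_minkowski: "isCont minkowski x"
proof -
  obtain C where C: "C > 0" "\<And>x y. \<bar>minkowski x - minkowski y\<bar> \<le> C * norm (x - y)"
    using minkowski_lipschitz by blast
  show ?thesis
    unfolding isCont_def tendsto_iff eventually_at
  proof (intro allI impI)
    fix e :: real
    assume "e > 0"
    have "dist (minkowski y) (minkowski x) < e" if "dist y x < e / C" for y
    proof -
      have "C * norm (y - x) < e"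
        using that C(1) by (simp add: dist_norm field_simps)
      moreover have "\<bar>minkowski y - minkowski x\<bar> \<le> C * norm (y - x)"
        by (rule C(2))
      ultimately show ?thesis
        by (simp add: dist_real_def)
    qed
    then show "\<exists>d>0. \<forall>y\<in>UNIV. y \<noteq> x \<and> dist y x < d \<longrightarrow> dist (minkowski y) (minkowski x) < e"
      using \<open>e > 0\<close> C(1) by (intro exI[of _ "e / C"]) simp
  qed
qed

lemma frontier_eq: "frontier K = {x. minkowski x = 1}"
proof -
  have "interior K = {x. minkowski x < 1}"
  proof (intro subset_antisym subsetI)
    fix x assume "x \<in> interior K"
    then obtain e where e: "e > 0" "ball x e \<subseteq> K"
      using mem_interior by blast
    show "x \<in> {x. minkowski x < 1}"
    proof (cases "x = 0")
      case False
      \<comment> \<open>Half the radius \<open>e\<close>, measured along \<open>x\<close>: pushing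
        \<open>x\<close> outwards by the factor \<open>1 + t\<close> stays in \<open>K\<close>,
        which forces the gauge of \<open>x\<close> strictly below 1.\<close>
      define t where "t = e / (2 * norm x)"
      have "t > 0"
        using False e(1) by (simp add: t_def)
      have "(1 + t) *\<^sub>R x \<in> ball x e"
        using False e(1) by (simp add: t_def dist_norm algebra_simps)
      then have "minkowski ((1 + t) *\<^sub>R x) \<le> 1"
        using e(2) body_iff by blast
      then have "(1 + t) * minkowski x \<le> 1"
        using \<open>t > 0\<close> minkowski_scale[of "1 + t" x] by simp
      moreover have "t * minkowski x > 0"
        using False \<open>t > 0\<close> minkowski_pos by simp
      ultimately show ?thesis
        by (simp add: algebra_simps)
    qed simp
  next
    have "open {x. minkowski x < 1}"
      using isCont_minkowski by (intro open_Collect_less continuous_at_imp_continuous_on) auto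
    moreover have "{x. minkowski x < 1} \<subseteq> K"
      using body_iff less_imp_le by blast
    ultimately show "x \<in> interior K" if "x \<in> {x. minkowski x < 1}" for x
      using that interior_maximal by blast
  qed
  moreover have "closure K = {x. minkowski x \<le> 1}"
    unfolding closure_closed[OF compact_imp_closed[OF compact_body]] using body_iff by blast
  ultimately show ?thesis
    by (auto simp: frontier_def)
qed

lemma frontier_nonzero: "p \<in> frontier K \<Longrightarrow> p \<noteq> 0"
  by (auto simp: frontier_eq)

lemma minkowski_normalize: "x \<noteq> 0 \<Longrightarrow> x /\<^sub>R minkowski x \<in> frontier K"
  using minkowski_pos[of x] minkowski_scale[of "inverse (minkowski x)" x] by (simp add: frontier_eq)

end

section \<open>Differentiability of the gauge\<close>

locale smooth_symmetric_body = symmetric_body +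
  assumes smooth_frontier: "smooth_hypersurface (frontier K)"
    and strict_frontier: "\<lbrakk>a \<in> frontier K; b \<in> frontier K; a \<noteq> b\<rbrakk> \<Longrightarrow> open_segment a b \<inter> frontier K = {}"
begin

text \<open>
  Near \<open>p\<close> the defining function \<open>f\<close> vanishes at the radial projection \<open>x / minkowski x\<close>; expanding
  this to first order determines the derivative of the gauge.
\<close>

lemma minkowski_differentiable_frontier:
  assumes p: "p \<in> frontier K"
  shows "minkowski differentiable (at p)"
proof -
  obtain V f where V: "open V" "p \<in> V" and smooth: "smooth_on f V"
    and ne: "frechet_derivative f (at p) \<noteq> (\<lambda>_. 0)" and level: "frontier K \<inter> V = {y \<in> V. f y = 0}"
    using smooth_frontier p unfolding smooth_hypersurface_def by meson
  define A where "A = frechet_derivative f (at p)"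
  have "Ck_on (Suc 0) f V"
    using smooth unfolding smooth_on_def by blast
  then have A: "(f has_derivative A) (at p)"
    using V(2) frechet_derivative_works unfolding A_def by auto
  then have lin: "bounded_linear A"
    by (rule has_derivative_bounded_linear)
  interpret A: bounded_linear A by (fact lin)
  have gp: "minkowski p = 1"
    using p by (simp add: frontier_eq)
  have fp: "f p = 0"
    using p V(2) level by blast
  obtain C where C: "C > 0" "\<And>x y. \<bar>minkowski x - minkowski y\<bar> \<le> C * norm (x - y)"
    using minkowski_lipschitz by blast
  \<comment> \<open>Bounds \<open>minkowski x *\<^sub>R (y - p)\<close> by a multiple of
    \<open>norm (x - p)\<close>, where \<open>y\<close> is the radial projection of
    \<open>x\<close>. Dividing the tolerance by this constant leaves exactly \<open>e\<close> at the
    end.\<close>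
  define C' where "C' = 1 + C * norm p"
  have C': "C' > 0"
    using C(1) by (simp add: C'_def add_pos_nonneg)
  \<comment> \<open>First order expansion of \<open>f (x /\<^sub>R minkowski x) = 0\<close> at
    \<open>p\<close>, multiplied through by \<open>minkowski x\<close>.\<close>
  have expansion: "\<exists>\<delta>>0. \<forall>x. norm (x - p) < \<delta> \<longrightarrow> \<bar>(1 - minkowski x) * A p + A (x - p)\<bar> \<le> e * norm (x - p)"
    if "e > 0" for e
  proof -
    have "e / C' > 0"
      using that C' by simp
    then obtain \<delta>1 where \<delta>1: "\<delta>1 > 0"
      "\<And>y. norm (y - p) < \<delta>1 \<Longrightarrow> norm (f y - f p - A (y - p)) \<le> e / C' * norm (y - p)"
      using A unfolding has_derivative_within_alt by auto
    have "((\<lambda>x. x /\<^sub>R minkowski x) \<longlongrightarrow> p /\<^sub>R minkowski p) (at p)"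
      using isCont_minkowski[of p] gp unfolding isCont_def by (intro tendsto_intros) auto
    then have lim: "((\<lambda>x. x /\<^sub>R minkowski x) \<longlongrightarrow> p) (at p)"
      using gp by simp
    have "eventually (\<lambda>x. x /\<^sub>R minkowski x \<in> V \<inter> ball p \<delta>1) (at p)"
      using V \<delta>1(1) by (intro topological_tendstoD[OF lim]) auto
    moreover have "eventually (\<lambda>x. x \<noteq> 0) (at p)"
      using frontier_nonzero[OF p] by (intro tendsto_imp_eventually_ne tendsto_ident_at) auto
    ultimately have "eventually (\<lambda>x. x /\<^sub>R minkowski x \<in> V \<inter> ball p \<delta>1 \<and> x \<noteq> 0) (at p)"
      by (rule eventually_conj)
    then obtain \<delta> where \<delta>: "\<delta> > 0"
      "\<And>x. x \<noteq> p \<Longrightarrow> dist x p < \<delta> \<Longrightarrow> x /\<^sub>R minkowski x \<in> V \<inter> ball p \<delta>1 \<and> x \<noteq> 0"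
      unfolding eventually_at by auto
    have "\<bar>(1 - minkowski x) * A p + A (x - p)\<bar> \<le> e * norm (x - p)" if x: "norm (x - p) < \<delta>" for x
    proof (cases "x = p")
      case True
      then show ?thesis
        by (simp add: gp A.zero)
    next
      case False
      define y where "y = x /\<^sub>R minkowski x"
      have y: "y \<in> V" "norm (y - p) < \<delta>1" "x \<noteq> 0"
        using \<delta>(2)[OF False] x by (auto simp: y_def dist_norm norm_minus_commute)
      have g: "minkowski x > 0"
        using y(3) by (rule minkowski_pos)
      have "y \<in> frontier K"
        unfolding y_def using y(3) by (rule minkowski_normalize)
      then have "f y = 0"
        using level y(1) by blast
      then have 1: "\<bar>A (y - p)\<bar> \<le> e / C' * norm (y - p)"
        using \<delta>1(2)[OF y(2)] fp by simp
      have 2: "minkowski x *\<^sub>R (y - p) = (1 - minkowski x) *\<^sub>R p + (x - p)"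
        using g by (simp add: y_def algebra_simps)
      have "\<bar>(1 - minkowski x) * A p + A (x - p)\<bar> = \<bar>minkowski x * A (y - p)\<bar>"
        using arg_cong[OF 2, of A] by (simp add: A.add A.scaleR)
      also have "\<dots> = minkowski x * \<bar>A (y - p)\<bar>"
        using g by (simp add: abs_mult)
      also have "\<dots> \<le> minkowski x * (e / C' * norm (y - p))"
        using 1 g by (intro mult_left_mono) auto
      also have "\<dots> = e / C' * norm (minkowski x *\<^sub>R (y - p))"
        using g by simp
      also have "\<dots> \<le> e / C' * (C' * norm (x - p))"
      proof (intro mult_left_mono)
        have "norm (minkowski x *\<^sub>R (y - p)) \<le> \<bar>1 - minkowski x\<bar> * norm p + norm (x - p)"
          unfolding 2 by (metis norm_scaleR norm_triangle_ineq)
        also have "\<dots> \<le> (C * norm (x - p)) * norm p + norm (x - p)"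
          using C(2)[of p x] gp by (intro add_right_mono mult_right_mono) (auto simp: norm_minus_commute)
        finally show "norm (minkowski x *\<^sub>R (y - p)) \<le> C' * norm (x - p)"
          by (simp add: C'_def algebra_simps)
      qed (use \<open>e > 0\<close> C' in simp)
      finally show ?thesis
        using C' by simp
    qed
    then show ?thesis
      using \<delta>(1) by blast
  qed
  \<comment> \<open>Transversality of the ray through \<open>p\<close> to the hypersurface. If
    \<open>A p\<close> vanished, the expansion would make \<open>A\<close> a derivative of the zero
    function, hence zero, against the regularity of \<open>f\<close> at \<open>p\<close>.\<close>
  have Ap: "A p \<noteq> 0"
  proof
    assume "A p = 0"
    then have "((\<lambda>_. 0) has_derivative A) (at p)"
      using expansion lin unfolding has_derivative_within_alt by simp
    then have "A = (\<lambda>_. 0)"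
      using has_derivative_unique[OF _ has_derivative_const] by blast
    then show False
      using ne by (simp add: A_def)
  qed
  \<comment> \<open>The expansion solved for \<open>minkowski x - 1\<close>.\<close>
  have "(minkowski has_derivative (\<lambda>d. A d / A p)) (at p)"
    unfolding has_derivative_within_alt
  proof (intro conjI allI impI)
    show "bounded_linear (\<lambda>d. A d / A p)"
      using lin by (rule bounded_linear_compose[OF bounded_linear_divide])
    fix e :: real
    assume "e > 0"
    then have "e * \<bar>A p\<bar> > 0"
      using Ap by simp
    then obtain \<delta> where \<delta>: "\<delta> > 0"
      "\<And>x. norm (x - p) < \<delta> \<Longrightarrow> \<bar>(1 - minkowski x) * A p + A (x - p)\<bar> \<le> e * \<bar>A p\<bar> * norm (x - p)"
      using expansion by blast
    have "norm (minkowski x - minkowski p - A (x - p) / A p) \<le> e * norm (x - p)" if "norm (x - p) < \<delta>" for x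
    proof -
      have "minkowski x - minkowski p - A (x - p) / A p = - ((1 - minkowski x) * A p + A (x - p)) / A p"
        using Ap gp by (simp add: field_simps)
      then show ?thesis
        using \<delta>(2)[OF that] Ap by (simp add: field_simps)
    qed
    then show "\<exists>d>0. \<forall>y\<in>UNIV. norm (y - p) < d \<longrightarrow>
        norm (minkowski y - minkowski p - A (y - p) / A p) \<le> e * norm (y - p)"
      using \<delta>(1) by blast
  qed
  then show ?thesis
    unfolding differentiable_def by blast
qed

text \<open>Degree one homogeneity makes the derivative homogeneous of degree zero: differentiate
  \<open>c * minkowski (y /\<^sub>R c) = minkowski y\<close>.\<close>

lemma has_derivative_minkowski_scale:
  assumes "(minkowski has_derivative D) (at x)" "c > 0"
  shows "(minkowski has_derivative D) (at (c *\<^sub>R x))"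
proof -
  have D: "(minkowski has_derivative D) (at ((c *\<^sub>R x) /\<^sub>R c))"
    using assms by simp
  have "((\<lambda>y. y /\<^sub>R c) has_derivative (\<lambda>h. h /\<^sub>R c)) (at (c *\<^sub>R x))"
    by (intro has_derivative_scaleR_right has_derivative_ident)
  from has_derivative_mult_right[OF has_derivative_compose[OF this D], of c]
  have "((\<lambda>y. c * minkowski (y /\<^sub>R c)) has_derivative (\<lambda>h. c * D (h /\<^sub>R c))) (at (c *\<^sub>R x))" .
  moreover have "c * minkowski (y /\<^sub>R c) = minkowski y" for y
    using assms(2) minkowski_scale[of "inverse c" y] by simp
  moreover have "c * D (h /\<^sub>R c) = D h" for h
    using linear_scale[OF has_derivative_linear[OF assms(1)], of "inverse c" h] assms(2) by simp
  ultimately show ?thesis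
    by simp
qed

text \<open>On the unit sphere this is the Legendre transform, as \<open>legendre_frontier\<close>
  shows.\<close>

definition dminkowski :: "'a \<Rightarrow> 'a \<Rightarrow> real" where
  "dminkowski x = frechet_derivative minkowski (at x)"

lemma has_derivative_minkowski: "x \<noteq> 0 \<Longrightarrow> (minkowski has_derivative dminkowski x) (at x)"
proof -
  assume "x \<noteq> 0"
  then obtain D where D: "(minkowski has_derivative D) (at (x /\<^sub>R minkowski x))"
    using minkowski_differentiable_frontier[OF minkowski_normalize] unfolding differentiable_def by blast
  have "(minkowski has_derivative D) (at (minkowski x *\<^sub>R (x /\<^sub>R minkowski x)))"
    by (rule has_derivative_minkowski_scale[OF D minkowski_pos[OF \<open>x \<noteq> 0\<close>]])
  then have "minkowski differentiable (at x)"
    using minkowski_pos[OF \<open>x \<noteq> 0\<close>] unfolding differentiable_def by auto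
  then show ?thesis
    unfolding dminkowski_def by (rule frechet_derivative_works[THEN iffD1])
qed

lemma dminkowski_scale: "\<lbrakk>x \<noteq> 0; c > 0\<rbrakk> \<Longrightarrow> dminkowski (c *\<^sub>R x) = dminkowski x"
  using has_derivative_minkowski_scale[OF has_derivative_minkowski] frechet_derivative_at dminkowski_def by metis

lemma bounded_linear_dminkowski: "x \<noteq> 0 \<Longrightarrow> bounded_linear (dminkowski x)"
  using has_derivative_minkowski has_derivative_bounded_linear by blast

lemma linear_dminkowski: "x \<noteq> 0 \<Longrightarrow> linear (dminkowski x)"
  using bounded_linear_dminkowski bounded_linear.linear by blast

lemma minkowski_has_real_derivative_line:
  assumes "x + r *\<^sub>R y \<noteq> 0"
  shows "((\<lambda>t. minkowski (x + t *\<^sub>R y)) has_real_derivative dminkowski (x + r *\<^sub>R y) y) (at r)"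
proof -
  have "((\<lambda>t. x + t *\<^sub>R y) has_derivative (\<lambda>t. t *\<^sub>R y)) (at r)"
    by (auto intro!: derivative_eq_intros)
  moreover have "(\<lambda>t. dminkowski (x + r *\<^sub>R y) (t *\<^sub>R y)) = (*) (dminkowski (x + r *\<^sub>R y) y)"
    by (simp add: fun_eq_iff linear_scale[OF linear_dminkowski[OF assms]] mult.commute)
  ultimately show ?thesis
    using has_derivative_compose[where f = "\<lambda>t. x + t *\<^sub>R y" and g = minkowski, OF _ has_derivative_minkowski[OF assms]]
    unfolding has_field_derivative_def by fastforce
qed

text \<open>Euler's identity for degree one homogeneity, read off along
  \<open>x + t *\<^sub>R x\<close>.\<close>

lemma dminkowski_self: "x \<noteq> 0 \<Longrightarrow> dminkowski x x = minkowski x"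
proof -
  assume x: "x \<noteq> 0"
  have "((\<lambda>t. minkowski (x + t *\<^sub>R x)) has_real_derivative dminkowski x x) (at 0)"
    using minkowski_has_real_derivative_line[of x 0 x] x by simp
  moreover have line: "(1 + t) * minkowski x = minkowski (x + t *\<^sub>R x)" if "dist t 0 < 1" for t
    using minkowski_scale[of "1 + t" x] that by (simp add: scaleR_add_left dist_real_def)
  have "((\<lambda>t. (1 + t) * minkowski x) has_real_derivative minkowski x) (at 0)"
    by (auto intro!: derivative_eq_intros)
  then have "((\<lambda>t. minkowski (x + t *\<^sub>R x)) has_real_derivative minkowski x) (at 0)"
    by (rule has_field_derivative_transform_within[where d = 1]) (use line in auto)
  ultimately show ?thesis
    by (rule DERIV_unique)
qed

text \<open>Subadditivity bounds the slope of the gauge in direction \<open>y\<close>: with a larger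
  slope, \<open>minkowski x + t * minkowski y - minkowski (x + t *\<^sub>R y)\<close>, which is 0 at
  \<open>t = 0\<close>, would be negative for small positive \<open>t\<close>.\<close>

lemma dminkowski_le: "x \<noteq> 0 \<Longrightarrow> dminkowski x y \<le> minkowski y"
proof (rule ccontr)
  assume x: "x \<noteq> 0" and "\<not> dminkowski x y \<le> minkowski y"
  then have neg: "minkowski y - dminkowski x y < 0"
    by simp
  have "((\<lambda>t. minkowski x + t * minkowski y - minkowski (x + t *\<^sub>R y)) has_real_derivative (minkowski y - dminkowski x y)) (at 0)"
    using minkowski_has_real_derivative_line[of x 0 y] x by (auto intro!: derivative_eq_intros)
  from DERIV_neg_dec_right[OF this neg] obtain d where d: "d > 0"
    "\<And>h. \<lbrakk>0 < h; h < d\<rbrakk> \<Longrightarrow> minkowski x + h * minkowski y - minkowski (x + h *\<^sub>R y) < 0"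
    by auto
  show False
    using d(2)[of "d/2"] d(1) minkowski_triangle[of x "(d/2) *\<^sub>R y"] minkowski_scale[of "d/2" y] by simp
qed

lemma dminkowski_frontier_self: "p \<in> frontier K \<Longrightarrow> dminkowski p p = 1"
  using dminkowski_self frontier_nonzero by (auto simp: frontier_eq)

lemma dminkowski_frontier_le: "\<lbrakk>p \<in> frontier K; x \<in> K\<rbrakk> \<Longrightarrow> dminkowski p x \<le> 1"
  using dminkowski_le[OF frontier_nonzero, of p x] by (simp add: body_iff)

section \<open>Supporting hyperplanes, tangent spaces and the Legendre transform\<close>

text \<open>The difference of the gauge and \<psi> is nonnegative with minimum 0 at
  \<open>p\<close>, so its derivative there vanishes.\<close>

lemma supporting_functional_unique:
  assumes p: "p \<in> frontier K" and \<psi>: "linear \<psi>" "\<And>x. x \<in> K \<Longrightarrow> \<psi> x \<le> 1" "\<psi> p = 1"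
  shows "\<psi> = dminkowski p"
proof -
  have le: "\<psi> x \<le> minkowski x" for x
  proof (cases "x = 0")
    case False
    have "x /\<^sub>R minkowski x \<in> K"
      using minkowski_normalize[OF False] compact_imp_closed[OF compact_body] frontier_subset_closed by blast
    then show ?thesis
      using \<psi>(2) minkowski_pos[OF False] by (fastforce simp: linear_scale[OF \<psi>(1)] field_simps)
  qed (simp add: linear_0[OF \<psi>(1)])
  have "((\<lambda>x. minkowski x - \<psi> x) has_derivative (\<lambda>h. dminkowski p h - \<psi> h)) (at p)"
    using has_derivative_minkowski[OF frontier_nonzero[OF p]] \<psi>(1)
    by (intro has_derivative_diff) (auto simp: linear_imp_has_derivative)
  then have "(\<lambda>h. dminkowski p h - \<psi> h) = (\<lambda>h. 0)"
    using p le \<psi>(3) by (intro differential_zero_maxmin[of p UNIV]) (auto simp: frontier_eq)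
  then show ?thesis
    by (simp add: fun_eq_iff)
qed

text \<open>Strict convexity: a second contact point of \<open>K\<close> with the supporting
  hyperplane at \<open>p\<close> would put the midpoint on the frontier.\<close>

lemma dminkowski_eq_one_imp_eq:
  assumes p: "p \<in> frontier K" and q: "q \<in> K" "dminkowski p q = 1"
  shows "q = p"
proof (rule ccontr)
  assume "q \<noteq> p"
  have "minkowski q = 1"
    using q dminkowski_le[OF frontier_nonzero[OF p], of q] by (simp add: body_iff)
  then have qf: "q \<in> frontier K"
    by (simp add: frontier_eq)
  have "dminkowski p (midpoint p q) = 1"
    using linear_dminkowski[OF frontier_nonzero[OF p]] dminkowski_frontier_self[OF p] q(2)
    by (simp add: midpoint_def linear_add linear_scale)
  then have "minkowski (midpoint p q) \<ge> 1"
    using dminkowski_le[OF frontier_nonzero[OF p], of "midpoint p q"] by simp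
  moreover have "midpoint p q \<in> K"
    using p q(1) convex_body compact_imp_closed[OF compact_body] frontier_subset_closed
    by (metis convex_contains_segment midpoint_in_closed_segment subsetD)
  ultimately have "midpoint p q \<in> frontier K"
    by (simp add: frontier_eq body_iff)
  moreover have "midpoint p q \<in> open_segment p q"
    using \<open>q \<noteq> p\<close> by simp
  ultimately show False
    using strict_frontier[OF p qf] \<open>q \<noteq> p\<close> by blast
qed

lemma tangent_space_frontier:
  assumes p: "p \<in> frontier K"
  shows "tangent_space (frontier K) p = {d. dminkowski p d = 0}"
proof (intro subset_antisym subsetI)
  have p0: "p \<noteq> 0"
    using p by (rule frontier_nonzero)
  fix d
  {
    assume "d \<in> tangent_space (frontier K) p"
    then obtain \<gamma> e where \<gamma>: "e > 0" "\<And>t::real. \<bar>t\<bar> < e \<Longrightarrow> \<gamma> t \<in> frontier K" "\<gamma> 0 = p"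
      "(\<gamma> has_vector_derivative d) (at 0)"
      unfolding tangent_space_def by blast
    have D: "(minkowski has_derivative dminkowski p) (at (\<gamma> 0))"
      using has_derivative_minkowski[OF p0] \<gamma>(3) by simp
    have "((\<lambda>t. minkowski (\<gamma> t)) has_derivative (\<lambda>t. dminkowski p (t *\<^sub>R d))) (at 0)"
      by (rule has_derivative_compose[OF \<gamma>(4)[unfolded has_vector_derivative_def] D])
    moreover have "(\<lambda>t. dminkowski p (t *\<^sub>R d)) = (*) (dminkowski p d)"
      by (simp add: fun_eq_iff linear_scale[OF linear_dminkowski[OF p0]] mult.commute)
    ultimately have "((\<lambda>t. minkowski (\<gamma> t)) has_real_derivative dminkowski p d) (at 0)"
      by (simp only: has_field_derivative_def)
    moreover have "((\<lambda>t. minkowski (\<gamma> t)) has_real_derivative 0) (at 0)"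
      by (rule has_field_derivative_transform_within[OF DERIV_const[of 1] \<gamma>(1)])
        (use \<gamma>(2) in \<open>auto simp: frontier_eq dist_real_def\<close>)
    ultimately show "d \<in> {d. dminkowski p d = 0}"
      using DERIV_unique by blast
  }
  {
    assume "d \<in> {d. dminkowski p d = 0}"
    then have d: "dminkowski p d = 0"
      by simp
    \<comment> \<open>Radial projection of the tangent line. Its normalising factor has derivative 0
      at \<open>t = 0\<close> because \<open>d\<close> is in the kernel, so the projected curve
      still has velocity \<open>d\<close>.\<close>
    define \<gamma> where "\<gamma> = (\<lambda>t. (p + t *\<^sub>R d) /\<^sub>R minkowski (p + t *\<^sub>R d))"
    have "((\<lambda>t. p + t *\<^sub>R d) \<longlongrightarrow> p + 0 *\<^sub>R d) (at 0)"
      by (intro tendsto_intros)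
    then have "eventually (\<lambda>t. p + t *\<^sub>R d \<noteq> 0) (at 0)"
      using p0 by (intro tendsto_imp_eventually_ne) auto
    then obtain e where e: "e > 0" "\<And>t. \<lbrakk>t \<noteq> 0; dist t 0 < e\<rbrakk> \<Longrightarrow> p + t *\<^sub>R d \<noteq> 0"
      unfolding eventually_at by auto
    have "\<gamma> t \<in> frontier K" if "\<bar>t\<bar> < e" for t
      unfolding \<gamma>_def using that e(2)[of t] p0 by (intro minkowski_normalize) (cases "t = 0", auto)
    moreover have gp: "minkowski p = 1"
      using p by (simp add: frontier_eq)
    then have "\<gamma> 0 = p"
      by (simp add: \<gamma>_def)
    moreover have "(\<gamma> has_vector_derivative d) (at 0)"
    proof -
      have "((\<lambda>t. minkowski (p + t *\<^sub>R d)) has_real_derivative 0) (at 0)"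
        using minkowski_has_real_derivative_line[of p 0 d] p0 d by simp
      then have "((\<lambda>t. inverse (minkowski (p + t *\<^sub>R d))) has_real_derivative 0) (at 0)"
        using DERIV_inverse'[of "\<lambda>t. minkowski (p + t *\<^sub>R d)" 0 0 UNIV] gp by simp
      moreover have "((\<lambda>t. p + t *\<^sub>R d) has_vector_derivative d) (at 0)"
        by (auto intro!: derivative_eq_intros)
      ultimately have "(\<gamma> has_vector_derivative
          (inverse (minkowski (p + 0 *\<^sub>R d)) *\<^sub>R d + 0 *\<^sub>R (p + 0 *\<^sub>R d))) (at 0)"
        unfolding \<gamma>_def by (intro has_vector_derivative_scaleR)
      then show ?thesis
        using gp by simp
    qed
    ultimately show "d \<in> tangent_space (frontier K) p"
      using e(1) unfolding tangent_space_def by blast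
  }
qed

text \<open>The two defining conditions determine the covector because every \<open>x\<close> is a
  multiple of \<open>p\<close> plus a vector in the kernel of \<open>dminkowski p\<close>.\<close>

lemma legendre_frontier:
  assumes p: "p \<in> frontier K"
  shows "blinfun_apply (legendre (frontier K) p) = dminkowski p"
proof -
  define w where "w = Blinfun (dminkowski p)"
  have p0: "p \<noteq> 0"
    using p by (rule frontier_nonzero)
  have w: "blinfun_apply w = dminkowski p"
    unfolding w_def by (intro bounded_linear_Blinfun_apply bounded_linear_dminkowski p0)
  have "legendre (frontier K) p = w"
    unfolding legendre_def tangent_space_frontier[OF p]
  proof (rule the_equality)
    show "blinfun_apply w p = 1 \<and> {d. blinfun_apply w d = 0} = {d. dminkowski p d = 0}"
      using dminkowski_frontier_self[OF p] by (simp add: w)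
    fix w' :: "'a \<Rightarrow>\<^sub>L real"
    assume w': "blinfun_apply w' p = 1 \<and> {d. blinfun_apply w' d = 0} = {d. dminkowski p d = 0}"
    show "w' = w"
    proof (rule blinfun_eqI)
      fix x
      have "dminkowski p (x - dminkowski p x *\<^sub>R p) = 0"
        using dminkowski_frontier_self[OF p]
        by (simp add: linear_diff[OF linear_dminkowski[OF p0]] linear_scale[OF linear_dminkowski[OF p0]])
      then have "blinfun_apply w' (x - dminkowski p x *\<^sub>R p) = 0"
        using w' by blast
      then show "blinfun_apply w' x = blinfun_apply w x"
        using w' by (simp add: w blinfun.diff_right blinfun.scaleR_right)
    qed
  qed
  then show ?thesis
    by (simp add: w)
qed

section \<open>Existence and uniqueness of the reflected point\<close>

text \<open>
  In the dual space, the covectors agreeing with \<open>dminkowski p\<close> on the hyperplane form a line, which meets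
  the dual unit sphere in exactly two points. The first is \<open>dminkowski p\<close>; the second is found by moving
  along the line until the boundary of the dual unit ball is reached again.
\<close>

lemma reflected_point_exists:
  assumes p: "p \<in> frontier K" and pos: "\<nu> \<bullet> p > 0"
  shows "\<exists>v\<in>frontier K. v \<noteq> p \<and> (\<forall>h. \<nu> \<bullet> h = 0 \<longrightarrow> dminkowski p h = dminkowski v h)"
proof -
  define w where "w = dminkowski p"
  have lin: "linear w"
    unfolding w_def by (intro linear_dminkowski frontier_nonzero p)
  have contw: "continuous_on A w" for A
    using lin by (simp add: linear_continuous_on linear_linear)
  have K0: "0 \<in> K"
    using zero_interior interior_subset by blast
  have pK: "p \<in> K"
    using p compact_imp_closed[OF compact_body] frontier_subset_closed by blast
  obtain B where B: "B > 0" "\<And>x. x \<in> K \<Longrightarrow> \<bar>\<nu> \<bullet> x\<bar> \<le> B"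
  proof -
    have "bounded ((\<lambda>x. \<nu> \<bullet> x) ` K)"
      by (intro compact_imp_bounded compact_continuous_image compact_body continuous_intros)
    then show thesis
      using that unfolding bounded_pos by auto
  qed
  \<comment> \<open>Parameters for which the shifted covector stays in the dual unit ball, that is,
    is at most 1 on \<open>K\<close>.\<close>
  define T where "T = {t. 0 \<le> t \<and> (\<forall>x\<in>K. w x - t * (\<nu> \<bullet> x) \<le> 1)}"
  \<comment> \<open>The covector can be moved at all: on the half of \<open>K\<close> with
    \<open>\<nu> \<bullet> x \<le> 0\<close>, strict convexity keeps \<open>w\<close> away from 1, a
    value it takes only at \<open>p\<close>. The gap \<open>1 - w z\<close>, divided by the bound
    \<open>B\<close>, is an admissible parameter.\<close>
  obtain \<tau> where \<tau>: "\<tau> > 0" "\<tau> \<in> T"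
  proof -
    define K' where "K' = K \<inter> {x. \<nu> \<bullet> x \<le> 0}"
    have "compact K'"
      unfolding K'_def by (intro compact_Int_closed compact_body closed_halfspace_le)
    moreover have "K' \<noteq> {}"
      using K0 by (auto simp: K'_def)
    ultimately obtain z where "z \<in> K'" "\<forall>x\<in>K'. w x \<le> w z"
      using continuous_attains_sup[of K' w] contw[of K'] by blast
    then have z: "z \<in> K" "\<nu> \<bullet> z \<le> 0" and max: "\<And>x. \<lbrakk>x \<in> K; \<nu> \<bullet> x \<le> 0\<rbrakk> \<Longrightarrow> w x \<le> w z"
      by (simp_all add: K'_def)
    have "w z \<noteq> 1"
      using dminkowski_eq_one_imp_eq[OF p z(1)] z(2) pos by (auto simp: w_def)
    then have wz: "w z < 1"
      using dminkowski_frontier_le[OF p z(1)] by (simp add: w_def)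
    define \<tau> where "\<tau> = (1 - w z) / B"
    have \<tau>: "\<tau> > 0" "\<tau> * B = 1 - w z"
      using wz B(1) by (simp_all add: \<tau>_def)
    have "w x - \<tau> * (\<nu> \<bullet> x) \<le> 1" if x: "x \<in> K" for x
    proof (cases "\<nu> \<bullet> x \<le> 0")
      case True
      have "- (\<tau> * (\<nu> \<bullet> x)) \<le> \<tau> * B"
        using B(2)[OF x] \<tau>(1) mult_left_mono[of "- (\<nu> \<bullet> x)" B \<tau>] by simp
      then show ?thesis
        using max[OF x True] \<tau>(2) by simp
    next
      case False
      then have "\<tau> * (\<nu> \<bullet> x) \<ge> 0"
        using \<tau>(1) by simp
      then show ?thesis
        using dminkowski_frontier_le[OF p x] by (simp add: w_def)
    qed
    then show thesis
      using that \<tau>(1) by (simp add: T_def)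
  qed
  \<comment> \<open>Testing at \<open>- p\<close>, where \<open>w\<close> equals -1, bounds the
    parameters.\<close>
  have bdd: "bdd_above T"
  proof (rule bdd_aboveI)
    fix t assume "t \<in> T"
    then have "w (- p) - t * (\<nu> \<bullet> (- p)) \<le> 1"
      using minus_body[OF pK] unfolding T_def by blast
    then have "t * (\<nu> \<bullet> p) \<le> 2"
      using dminkowski_frontier_self[OF p] linear_neg[OF lin, of p] by (simp add: w_def)
    then show "t \<le> 2 / (\<nu> \<bullet> p)"
      using pos by (simp add: field_simps)
  qed
  have "T = {0..} \<inter> (\<Inter>x\<in>K. {t. w x - t * (\<nu> \<bullet> x) \<le> 1})"
    unfolding T_def by auto
  moreover have "closed \<dots>"
    by (intro closed_Int closed_INT ballI closed_Collect_le closed_real_atLeast continuous_intros)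
  ultimately have "closed T"
    by simp
  define t where "t = Sup T"
  have t: "t \<in> T" "t > 0"
    using closed_contains_Sup[OF _ bdd \<open>closed T\<close>] cSup_upper[OF \<tau>(2) bdd] \<tau> by (auto simp: t_def)
  define \<psi> where "\<psi> = (\<lambda>x. w x - t * (\<nu> \<bullet> x))"
  have lin\<psi>: "linear \<psi>"
    unfolding \<psi>_def using lin
    by (auto intro!: linearI simp: linear_add linear_scale inner_right_distrib algebra_simps)
  have \<psi>_le: "\<psi> x \<le> 1" if "x \<in> K" for x
    using t(1) that by (simp add: T_def \<psi>_def)
  have "continuous_on K \<psi>"
    unfolding \<psi>_def by (intro continuous_intros contw)
  then obtain v where v: "v \<in> K" "\<And>x. x \<in> K \<Longrightarrow> \<psi> x \<le> \<psi> v"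
    using continuous_attains_sup[OF compact_body] K0 by blast
  \<comment> \<open>At the largest parameter the maximum over \<open>K\<close> must be 1, since a
    remaining gap would allow a larger parameter.\<close>
  have \<psi>v: "\<psi> v = 1"
  proof (rule ccontr)
    assume "\<psi> v \<noteq> 1"
    then have less: "\<psi> v < 1"
      using \<psi>_le[OF v(1)] by simp
    define \<epsilon> where "\<epsilon> = (1 - \<psi> v) / B"
    have \<epsilon>: "\<epsilon> > 0" "\<epsilon> * B = 1 - \<psi> v"
      using less B(1) by (simp_all add: \<epsilon>_def)
    have "w x - (t + \<epsilon>) * (\<nu> \<bullet> x) \<le> 1" if x: "x \<in> K" for x
    proof -
      have "- (\<epsilon> * (\<nu> \<bullet> x)) \<le> \<epsilon> * B"
        using B(2)[OF x] \<epsilon>(1) mult_left_mono[of "- (\<nu> \<bullet> x)" B \<epsilon>] by simp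
      then show ?thesis
        using v(2)[OF x] \<epsilon>(2) by (simp add: \<psi>_def algebra_simps)
    qed
    then have "t + \<epsilon> \<in> T"
      using t \<epsilon>(1) by (simp add: T_def)
    then show False
      using cSup_upper[OF _ bdd] \<epsilon>(1) by (fastforce simp: t_def)
  qed
  have "minkowski v \<noteq> 0"
    using \<psi>v linear_0[OF lin\<psi>] minkowski_pos[of v] by force
  have "\<not> minkowski v < 1"
  proof
    assume less: "minkowski v < 1"
    have v0: "v \<noteq> 0"
      using \<open>minkowski v \<noteq> 0\<close> by auto
    have "v /\<^sub>R minkowski v \<in> K"
      using minkowski_normalize[OF v0] compact_imp_closed[OF compact_body] frontier_subset_closed by blast
    then have "\<psi> (v /\<^sub>R minkowski v) \<le> 1"
      by (rule \<psi>_le)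
    then show False
      using less minkowski_pos[OF v0] \<psi>v by (simp add: linear_scale[OF lin\<psi>] field_simps)
  qed
  then have vf: "v \<in> frontier K"
    using v(1) by (simp add: frontier_eq body_iff)
  have \<psi>: "\<psi> = dminkowski v"
    by (rule supporting_functional_unique[OF vf lin\<psi> \<psi>_le \<psi>v])
  have "\<psi> p \<noteq> 1"
    using t(2) pos dminkowski_frontier_self[OF p] by (simp add: \<psi>_def w_def)
  then have "v \<noteq> p"
    using \<psi>v by auto
  moreover have "dminkowski p h = dminkowski v h" if "\<nu> \<bullet> h = 0" for h
    using that by (simp add: \<psi>_def w_def flip: \<psi>)
  ultimately show ?thesis
    using vf by blast
qed

text \<open>A line meets the dual unit sphere at most twice. Evaluated at \<open>q2\<close>, the
  covectors on it form an affine function of the parameter that reaches its bound 1 at the middle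
  one, so \<open>m q2 = 0\<close>. Then \<open>dminkowski q1\<close> is also 1 at \<open>q2\<close>,
  and strict convexity applies.\<close>

lemma frontier_eq_of_collinear:
  assumes q: "q1 \<in> frontier K" "q2 \<in> frontier K" "q3 \<in> frontier K"
    and eq: "\<And>x. dminkowski q1 x = \<phi> x + a * m x" "\<And>x. dminkowski q2 x = \<phi> x + b * m x"
      "\<And>x. dminkowski q3 x = \<phi> x + c * m x"
    and "a < b" "b < (c::real)"
  shows "q1 = q2"
proof -
  have K: "q2 \<in> K"
    using q(2) compact_imp_closed[OF compact_body] frontier_subset_closed by blast
  have 1: "\<phi> q2 + b * m q2 = 1" "\<phi> q2 + a * m q2 \<le> 1" "\<phi> q2 + c * m q2 \<le> 1"
    using dminkowski_frontier_self[OF q(2)] dminkowski_frontier_le[OF q(1) K] dminkowski_frontier_le[OF q(3) K]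
    by (simp_all add: eq)
  then have "(b - a) * m q2 \<ge> 0" "(c - b) * m q2 \<le> 0"
    by (simp_all add: algebra_simps)
  then have "m q2 = 0"
    using \<open>a < b\<close> \<open>b < c\<close> by (simp add: zero_le_mult_iff mult_le_0_iff)
  then have "dminkowski q1 q2 = 1"
    using 1 by (simp add: eq)
  then show ?thesis
    using dminkowski_eq_one_imp_eq[OF q(1) K] by simp
qed

text \<open>Covectors agreeing on the hyperplane differ by a multiple of \<nu>. The images of
  \<open>p\<close>, \<open>v1\<close>, \<open>v2\<close> are thus collinear with parameters 0,
  \<open>coef v1\<close>, \<open>coef v2\<close>, and \<open>frontier_eq_of_collinear\<close> leaves
  no room for three distinct points.\<close>

lemma reflected_point_unique:
  assumes p: "p \<in> frontier K" "\<nu> \<bullet> p \<noteq> 0"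
    and v1: "v1 \<in> frontier K" "v1 \<noteq> p" "\<And>h. \<nu> \<bullet> h = 0 \<Longrightarrow> dminkowski p h = dminkowski v1 h"
    and v2: "v2 \<in> frontier K" "v2 \<noteq> p" "\<And>h. \<nu> \<bullet> h = 0 \<Longrightarrow> dminkowski p h = dminkowski v2 h"
  shows "v1 = v2"
proof -
  define coef where "coef = (\<lambda>v. (dminkowski v p - dminkowski p p) / (\<nu> \<bullet> p))"
  have eq: "dminkowski v x = dminkowski p x + coef v * (\<nu> \<bullet> x)"
    if v: "v \<in> frontier K" "\<And>h. \<nu> \<bullet> h = 0 \<Longrightarrow> dminkowski p h = dminkowski v h" for v x
  proof -
    note lin = linear_dminkowski[OF frontier_nonzero[OF v(1)]] linear_dminkowski[OF frontier_nonzero[OF p(1)]]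
    define h where "h = x - ((\<nu> \<bullet> x) / (\<nu> \<bullet> p)) *\<^sub>R p"
    have "\<nu> \<bullet> h = 0"
      using p(2) by (simp add: h_def inner_diff_right)
    from v(2)[OF this] show ?thesis
      using p(2) by (simp add: h_def coef_def linear_diff[OF lin(1)] linear_scale[OF lin(1)]
        linear_diff[OF lin(2)] linear_scale[OF lin(2)] field_simps)
  qed
  have eq0: "dminkowski p x = dminkowski p x + 0 * (\<nu> \<bullet> x)" for x
    by simp
  note e1 = eq[OF v1(1,3)] and e2 = eq[OF v2(1,3)]
  \<comment> \<open>Injectivity of the Legendre transform, by strict convexity; distinct points
    therefore get distinct parameters.\<close>
  have *: "q = q'" if "q \<in> frontier K" "q' \<in> frontier K" "dminkowski q = dminkowski q'" for q q'
    using that dminkowski_eq_one_imp_eq[of q q'] dminkowski_frontier_self[of q'] 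
      compact_imp_closed[OF compact_body] frontier_subset_closed by fastforce
  have "coef v1 \<noteq> 0"
    using *[OF v1(1) p(1)] v1(2) e1 by (auto simp: fun_eq_iff)
  moreover have "coef v2 \<noteq> 0"
    using *[OF v2(1) p(1)] v2(2) e2 by (auto simp: fun_eq_iff)
  moreover have "v1 = v2" if "coef v1 = coef v2"
    using *[OF v1(1) v2(1)] that e1 e2 by (auto simp: fun_eq_iff)
  \<comment> \<open>All six strict orderings of the three parameters.\<close>
  moreover note frontier_eq_of_collinear[OF p(1) v1(1) v2(1) eq0 e1 e2]
    frontier_eq_of_collinear[OF p(1) v2(1) v1(1) eq0 e2 e1]
    frontier_eq_of_collinear[OF v1(1) p(1) v2(1) e1 eq0 e2]
    frontier_eq_of_collinear[OF v2(1) p(1) v1(1) e2 eq0 e1]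
    frontier_eq_of_collinear[OF v1(1) v2(1) p(1) e1 e2 eq0]
    frontier_eq_of_collinear[OF v2(1) v1(1) p(1) e2 e1 eq0]
  ultimately show ?thesis
    using v1(2) v2(2) by (metis linorder_neqE_linordered_idom)
qed

text \<open>Existence and uniqueness make the definite description meaningful;
  \<open>- \<nu>\<close> takes the place of \<nu> for points on the negative side.\<close>

lemma finsler_reflection_frontier:
  assumes p: "p \<in> frontier K" "\<nu> \<bullet> p \<noteq> 0"
  defines "v \<equiv> finsler_reflection (frontier K) {x. \<nu> \<bullet> x = 0} p"
  shows "v \<in> frontier K" "\<And>h. \<nu> \<bullet> h = 0 \<Longrightarrow> dminkowski p h = dminkowski v h"
proof -
  define P where "P = (\<lambda>v. v \<in> frontier K \<and> v \<noteq> p \<and>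
    (\<forall>h\<in>{x. \<nu> \<bullet> x = 0}. blinfun_apply (legendre (frontier K) p - legendre (frontier K) v) h = 0))"
  have P: "P v \<longleftrightarrow> v \<in> frontier K \<and> v \<noteq> p \<and> (\<forall>h. \<nu> \<bullet> h = 0 \<longrightarrow> dminkowski p h = dminkowski v h)" for v
    using legendre_frontier p(1) by (auto simp: P_def blinfun.diff_left)
  have "\<exists>v. P v"
    using reflected_point_exists[OF p(1), of \<nu>] reflected_point_exists[OF p(1), of "- \<nu>"] p(2)
    unfolding P by (cases "\<nu> \<bullet> p > 0") auto
  moreover have "v1 = v2" if "P v1" "P v2" for v1 v2
    using that reflected_point_unique[OF p, of v1 v2] unfolding P by blast
  ultimately have "P (THE v. P v)"
    by (metis theI)
  then have "P v"
    using p(2) by (simp add: v_def finsler_reflection_def P_def)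
  then show "v \<in> frontier K" "\<And>h. \<nu> \<bullet> h = 0 \<Longrightarrow> dminkowski p h = dminkowski v h"
    by (auto simp: P)
qed

section \<open>Invariance of the gauge under the linear reflection\<close>

text \<open>The law controls oriented directions only, which suffices because
  \<open>dminkowski\<close> is unchanged by positive scaling.\<close>

lemma minkowski_reflection_invariant:
  assumes n: "\<nu> \<bullet> n \<noteq> 0"
    and s: "linear s" "\<And>h. \<nu> \<bullet> h = 0 \<Longrightarrow> s h = h" "s n = - n"
    and refl: "\<And>u. u \<in> frontier K \<Longrightarrow>
      \<exists>c>0. finsler_reflection (frontier K) {x. \<nu> \<bullet> x = 0} u = c *\<^sub>R s u"
  shows "minkowski (s x) = minkowski x"
proof -
  have dminkowski_s: "dminkowski (s x) h = dminkowski x h" if x: "\<nu> \<bullet> x \<noteq> 0" and h: "\<nu> \<bullet> h = 0" for x h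
  proof -
    have x0: "x \<noteq> 0"
      using x by auto
    define u where "u = x /\<^sub>R minkowski x"
    have u: "u \<in> frontier K" "\<nu> \<bullet> u \<noteq> 0"
      using minkowski_normalize[OF x0] minkowski_pos[OF x0] x by (auto simp: u_def)
    obtain c where c: "c > 0" "finsler_reflection (frontier K) {x. \<nu> \<bullet> x = 0} u = c *\<^sub>R s u"
      using refl[OF u(1)] by blast
    have v: "c *\<^sub>R s u \<in> frontier K" "dminkowski u h = dminkowski (c *\<^sub>R s u) h"
      using finsler_reflection_frontier[OF u] h c(2) by auto
    have "c *\<^sub>R s u = (c / minkowski x) *\<^sub>R s x"
      by (simp add: u_def linear_scale[OF s(1)] divide_inverse)
    moreover have "s x \<noteq> 0"
      using frontier_nonzero[OF v(1)] calculation by auto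
    ultimately have "dminkowski (c *\<^sub>R s u) = dminkowski (s x)"
      using dminkowski_scale c(1) minkowski_pos[OF x0] by simp
    moreover have "dminkowski u = dminkowski x"
      unfolding u_def using dminkowski_scale[OF x0] minkowski_pos[OF x0] by simp
    ultimately show ?thesis
      using v(2) by simp
  qed
  define t where "t = (\<nu> \<bullet> x) / (\<nu> \<bullet> n)"
  define h where "h = x - t *\<^sub>R n"
  have h: "\<nu> \<bullet> h = 0" and x: "x = t *\<^sub>R n + h"
    using n by (simp_all add: h_def t_def inner_diff_right)
  show ?thesis
  proof (cases "t = 0")
    case True
    then show ?thesis
      using h x s(2) by simp
  next
    case False
    have sline: "s (t *\<^sub>R n + r *\<^sub>R h) = - t *\<^sub>R n + r *\<^sub>R h" for r
      using s(2)[OF h] s(3) by (simp add: linear_add[OF s(1)] linear_scale[OF s(1)])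
    \<comment> \<open>Difference of the gauge and its reflection along the line through
      \<open>t *\<^sub>R n\<close> in direction \<open>h\<close>; it vanishes at
      \<open>r = 0\<close> because the gauge is even.\<close>
    define G where "G = (\<lambda>r. minkowski (t *\<^sub>R n + r *\<^sub>R h) - minkowski (- t *\<^sub>R n + r *\<^sub>R h))"
    have "(G has_real_derivative 0) (at r)" for r
    proof -
      have nz: "\<nu> \<bullet> (t *\<^sub>R n + r *\<^sub>R h) \<noteq> 0" "\<nu> \<bullet> (- t *\<^sub>R n + r *\<^sub>R h) \<noteq> 0"
        using False n h by (simp_all add: inner_right_distrib inner_diff_right)
      then have "t *\<^sub>R n + r *\<^sub>R h \<noteq> 0" "- t *\<^sub>R n + r *\<^sub>R h \<noteq> 0"
        by (metis inner_zero_right)+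
      then have "(G has_real_derivative
          (dminkowski (t *\<^sub>R n + r *\<^sub>R h) h - dminkowski (- t *\<^sub>R n + r *\<^sub>R h) h)) (at r)"
        unfolding G_def by (intro DERIV_diff minkowski_has_real_derivative_line)
      then show ?thesis
        using dminkowski_s[OF nz(1) h] sline[of r] by simp
    qed
    then have "G 1 = G 0"
      by (intro DERIV_isconst_all) blast
    then have "minkowski (t *\<^sub>R n + h) = minkowski (- t *\<^sub>R n + h)"
      using minkowski_minus[of "t *\<^sub>R n"] by (simp add: G_def)
    then show ?thesis
      using sline[of 1] x by simp
  qed
qed

end

section \<open>From an indicatrix to a smooth symmetric body\<close>

text \<open>\<open>K\<close> is the convex hull of its frontier, so central symmetry passes from the
  sphere to the body; averaging an interior point with its negative then shows that the origin is
  interior.\<close>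

lemma indicatrix_smooth_symmetric_body:
  fixes S :: "'a::euclidean_space set"
  assumes "indicatrix S"
  obtains K where "smooth_symmetric_body K" "S = frontier K"
proof -
  obtain K where K: "compact K" "convex K" "interior K \<noteq> {}" and S: "S = frontier K"
    using assms unfolding indicatrix_def strictly_convex_closed_hypersurface_def by blast
  have hull: "K = convex hull S"
    unfolding S by (rule Krein_Milman_frontier[OF K(2,1)])
  have "uminus ` S = S"
  proof (intro subset_antisym subsetI)
    have minus: "- v \<in> S" if "v \<in> S" for v
      using assms that unfolding indicatrix_def by blast
    show "x \<in> S" if "x \<in> uminus ` S" for x
      using that minus by auto
    show "x \<in> uminus ` S" if "x \<in> S" for x
      using minus[OF that] by (rule image_eqI[rotated]) simp
  qed
  then have sym: "uminus ` K = K"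
    using convex_hull_linear_image[of "uminus :: 'a \<Rightarrow> 'a" S] linear_uminus by (simp add: hull)
  obtain a where a: "a \<in> interior K"
    using K(3) by blast
  have "interior (uminus ` K) = uminus ` interior K"
    by (rule interior_negations)
  then have "- a \<in> interior K"
    using a sym by auto
  then have "(1/2) *\<^sub>R a + (1/2) *\<^sub>R (- a) \<in> interior K"
    using a by (intro convexD[OF convex_interior[OF K(2)]]) auto
  then have "0 \<in> interior K"
    by simp
  then have "smooth_symmetric_body K"
    using assms K sym S
    unfolding indicatrix_def strictly_convex_closed_hypersurface_def
    by unfold_locales auto
  then show thesis
    using that S by blast
qed

section \<open>Bodies invariant under many reflections\<close>

lemma absolutely_integrable_on_compact:
  fixes f :: "'a::euclidean_space \<Rightarrow> 'b::euclidean_space"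
  assumes "compact B" "continuous_on B f"
  shows "f absolutely_integrable_on B"
  using borel_integrable_compact[OF assms]
  by (simp add: set_integrable_def integrable_completion borel_measurable_continuous_on_indicator[OF _ assms(2)] 
      borel_compact[OF assms(1)] indicator_scaleR_eq_if)

text \<open>The determinant of an involution squares to 1, so the change of variables has unit
  Jacobian.\<close>

lemma integral_involution:
  fixes \<sigma> :: "real^'m::{finite,wellorder} \<Rightarrow> real^'m::_" and f :: "real^'m::_ \<Rightarrow> real^'n"
  assumes "linear \<sigma>" and "\<And>w. \<sigma> (\<sigma> w) = w" and "\<sigma> ` B = B"
    and "f absolutely_integrable_on B"
  shows "integral B (\<lambda>w. f (\<sigma> w)) = integral B f"
proof -
  have "\<sigma> \<circ> \<sigma> = id"
    using assms(2) by auto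
  then have "matrix \<sigma> ** matrix \<sigma> = mat 1"
    by (metis assms(1) matrix_compose matrix_id_mat_1)
  then have "det (matrix \<sigma>) * det (matrix \<sigma>) = 1"
    by (metis det_I det_mul)
  then have "\<bar>det (matrix \<sigma>)\<bar> = 1"
    by (metis abs_1 abs_mult abs_square_eq_1 power2_eq_square)
  then show ?thesis
    using integral_change_of_variables_linear[OF assms(1), where f = f and S = B] assms(3,4)
    by (simp add: o_def)
qed

text \<open>Yields positive definiteness of the second moments. A vanishing integral would force
  \<open>y \<bullet> p w\<close> to be 0 on a whole box, but a small shift inside it along a
  preimage of \<open>y\<close> changes the value by a positive multiple of
  \<open>y \<bullet> y\<close>.\<close>

lemma integral_square_pos:
  fixes p :: "'a::euclidean_space \<Rightarrow> 'b::euclidean_space"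
  assumes "compact B" "interior B \<noteq> {}" "linear p" "surj p" "y \<noteq> 0"
  shows "integral B (\<lambda>w. (y \<bullet> p w)\<^sup>2) > 0"
proof -
  obtain w0 where "w0 \<in> interior B"
    using assms(2) by auto
  then obtain a b where ab: "w0 \<in> box a b" "cbox a b \<subseteq> interior B"
    by (meson open_contains_cbox open_interior)
  have cont: "continuous_on A (\<lambda>w. (y \<bullet> p w)\<^sup>2)" for A
    using linear_continuous_on[of p A] assms(3) by (intro continuous_intros) (simp add: linear_linear)
  have int: "(\<lambda>w. (y \<bullet> p w)\<^sup>2) integrable_on B"
    using absolutely_integrable_on_compact[OF assms(1) cont] set_lebesgue_integral_eq_integral(1) by blast
  have le: "integral (cbox a b) (\<lambda>w. (y \<bullet> p w)\<^sup>2) \<le> integral B (\<lambda>w. (y \<bullet> p w)\<^sup>2)"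
    using ab(2) interior_subset by (intro integral_subset_le) (auto intro: integrable_continuous cont int)
  have "integral (cbox a b) (\<lambda>w. (y \<bullet> p w)\<^sup>2) \<noteq> 0"
  proof
    assume "integral (cbox a b) (\<lambda>w. (y \<bullet> p w)\<^sup>2) = 0"
    then have z: "y \<bullet> p w = 0" if "w \<in> cbox a b" for w
      using integral_cbox_eq_0_iff[of a b "\<lambda>w. (y \<bullet> p w)\<^sup>2"] ab(1) cont that by auto
    obtain v where v: "p v = y"
      using assms(4) by (metis surjD)
    obtain e where e: "e > 0" "ball w0 e \<subseteq> box a b"
      using ab(1) open_box open_contains_ball by blast
    define t where "t = (e / 2) / (1 + norm v)"
    have t: "t > 0" "norm (t *\<^sub>R v) < e"
    proof -
      show "t > 0"
        using e(1) by (simp add: t_def add_pos_nonneg)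
      have "1 + norm v \<noteq> 0"
        using norm_ge_zero[of v] by linarith
      then have "t * (1 + norm v) = e / 2"
        unfolding t_def by (rule nonzero_eq_divide_eq[THEN iffD1]) (rule refl)
      then have "t * norm v \<le> e / 2"
        using \<open>t > 0\<close> by (simp add: algebra_simps)
      then show "norm (t *\<^sub>R v) < e"
        using \<open>t > 0\<close> e(1) by simp
    qed
    then have "w0 + t *\<^sub>R v \<in> cbox a b"
      using e(2) box_subset_cbox by (force simp: dist_norm)
    then have "y \<bullet> p (w0 + t *\<^sub>R v) = 0" "y \<bullet> p w0 = 0"
      using z ab(1) box_subset_cbox by blast+
    then have "t * (y \<bullet> y) = 0"
      using assms(3) v by (simp add: linear_add linear_scale inner_right_distrib)
    then show False
      using t assms(5) by simp
  qed
  moreover have "integral (cbox a b) (\<lambda>w. (y \<bullet> p w)\<^sup>2) \<ge> 0"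
    by (intro integral_nonneg integrable_continuous cont) auto
  ultimately show ?thesis
    using le by linarith
qed

text \<open>
  \<open>M\<close> is the covariance operator of \<open>K\<close>. The change of variables formula of the library needs a
  well-ordered index type, so the second moments are integrated over \<open>K \<times> K\<close>, viewed as a subset of
  \<open>real ^ 'n bit0\<close>.
\<close>

lemma exists_invariant_operator:
  fixes K :: "(real^'n) set"
  assumes "compact K" "interior K \<noteq> {}"
  obtains M :: "real^'n \<Rightarrow> real^'n"
  where "linear M" "\<And>x y. x \<bullet> M y = M x \<bullet> y" "\<And>y. y \<noteq> 0 \<Longrightarrow> y \<bullet> M y > 0"
    "\<And>s z. \<lbrakk>linear s; \<And>x. s (s x) = x; s ` K \<subseteq> K\<rbrakk> \<Longrightarrow> s (M (adjoint s z)) = M z"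
proof -
  obtain \<phi> :: "(real^'n) \<times> (real^'n) \<Rightarrow> real^('n bit0)" and \<psi>
    where lin: "linear \<phi>" "linear \<psi>" and inv: "\<And>x. \<psi> (\<phi> x) = x" "\<And>y. \<phi> (\<psi> y) = y"
    by (rule isomorphisms_UNIV_UNIV[where 'M="(real^'n) \<times> (real^'n)" and 'N="real^('n bit0)"]) auto
  define B where "B = \<phi> ` (K \<times> K)"
  define p where "p = fst \<circ> \<psi>"
  have linp: "linear p"
    unfolding p_def by (intro linear_compose lin linear_fst)
  have surjp: "surj p"
    unfolding p_def by (intro comp_surj) (metis inv(1) surjI, auto)
  have contp: "continuous_on A p" for A
    using linp by (simp add: linear_continuous_on linear_linear)
  have B: "compact B"
    unfolding B_def using lin assms(1)
    by (intro compact_continuous_image compact_Times linear_continuous_on) (simp_all add: linear_linear)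
  have "open (\<psi> -` (interior K \<times> interior K))"
    using lin(2) by (intro open_vimage open_Times linear_continuous_on) (simp_all add: linear_linear)
  moreover have "\<psi> -` (interior K \<times> interior K) \<subseteq> B"
    unfolding B_def using interior_subset inv(2) by (force intro: image_eqI[of _ \<phi> "\<psi> x" for x])
  moreover obtain k where "k \<in> interior K"
    using assms(2) by auto
  then have "\<phi> (k, k) \<in> \<psi> -` (interior K \<times> interior K)"
    by (simp add: inv)
  ultimately have intB: "interior B \<noteq> {}"
    using interior_maximal by blast
  \<comment> \<open>The integrand depends only on the first factor, so up to a positive constant
    this is the second moment operator of \<open>K\<close>.\<close>
  define M where "M = (\<lambda>y. integral B (\<lambda>w. (y \<bullet> p w) *\<^sub>R p w))"
  have ai: "(\<lambda>w. (y \<bullet> p w) *\<^sub>R p w) absolutely_integrable_on B" for y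
    by (intro absolutely_integrable_on_compact B continuous_intros contp)
  have int: "(\<lambda>w. (y \<bullet> p w) *\<^sub>R p w) integrable_on B" for y
    using ai set_lebesgue_integral_eq_integral(1) by blast
  have inner_M: "x \<bullet> M y = integral B (\<lambda>w. (y \<bullet> p w) * (x \<bullet> p w))" for x y
    using integral_linear[OF int[of y] bounded_linear_inner_right[of x]] by (simp add: M_def o_def)
  show thesis
  proof
    show "linear M"
    proof
      show "M (x + y) = M x + M y" for x y
        unfolding M_def by (simp add: inner_add_left scaleR_add_left integral_add int)
      show "M (c *\<^sub>R x) = c *\<^sub>R M x" for c x
        unfolding M_def by (simp flip: scaleR_scaleR)
    qed
    show "x \<bullet> M y = M x \<bullet> y" for x y
      using inner_M[of x y] inner_M[of y x] by (simp add: inner_commute mult.commute)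
    show "y \<bullet> M y > 0" if "y \<noteq> 0" for y
      using integral_square_pos[OF B intB linp surjp that] by (simp add: inner_M power2_eq_square)
    fix s :: "real^'n \<Rightarrow> real^'n" and z
    assume s: "linear s" "\<And>x. s (s x) = x" "s ` K \<subseteq> K"
    have sK: "s ` K = K"
    proof (intro subset_antisym s(3) subsetI)
      fix x assume "x \<in> K"
      then have "s x \<in> K"
        using s(3) by auto
      then show "x \<in> s ` K"
        by (metis imageI s(2))
    qed
    \<comment> \<open>\<open>s\<close> acting on both factors at once, transported by \<phi>: an
      involution that preserves \<open>B\<close> and induces \<open>s\<close> on the first
      factor.\<close>
    define \<sigma> where "\<sigma> = \<phi> \<circ> map_prod s s \<circ> \<psi>"
    have "linear (map_prod s s)"
      by (intro linearI) (simp_all add: prod_eq_iff linear_add[OF s(1)] linear_scale[OF s(1)])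
    then have lins: "linear \<sigma>"
      unfolding \<sigma>_def by (intro linear_compose lin)
    have "\<sigma> (\<sigma> w) = w" for w
      by (cases "\<psi> w") (metis \<sigma>_def comp_apply inv map_prod_simp s(2))
    moreover have "map_prod s s ` (K \<times> K) = K \<times> K"
      using sK by (rule map_prod_surj_on[OF _ sK])
    then have "\<sigma> ` B = B"
      unfolding B_def by (metis (no_types, lifting) \<sigma>_def comp_apply image_cong image_image inv(1))
    moreover have p\<sigma>: "p (\<sigma> w) = s (p w)" for w
      by (simp add: p_def \<sigma>_def inv)
    \<comment> \<open>Substituting \<open>\<sigma> w\<close> leaves the integral unchanged; pulling
      \<open>s\<close> out of it and moving the other \<open>s\<close> across the inner product
      gives the invariance.\<close>
    ultimately have "integral B (\<lambda>w. (z \<bullet> s (p w)) *\<^sub>R s (p w)) = M z"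
      using integral_involution[OF lins _ _ ai, of z] by (simp add: M_def)
    moreover have "s (M (adjoint s z)) = integral B (\<lambda>w. (adjoint s z \<bullet> p w) *\<^sub>R s (p w))"
      using integral_linear[OF int[of "adjoint s z"], of s] s(1)
      by (simp add: M_def o_def linear_scale linear_linear)
    ultimately show "s (M (adjoint s z)) = M z"
      using adjoint_works[OF s(1)] by (simp add: inner_commute)
  qed
qed

section \<open>From reflections to the ellipsoid\<close>

text \<open>For the inner product \<open>g\<close> given by the inverse of \<open>M\<close>, the
  maps in \<open>refl\<close> are the orthogonal reflections. They exchange any two distinct vectors
  of equal \<open>g\<close>-length, so \<open>F\<close> depends only on that length, and homogeneity
  makes \<open>g x x\<close> a multiple of \<open>(F x)\<^sup>2\<close>.\<close>

lemma ellipsoid_level_set: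
  fixes F :: "real^'n \<Rightarrow> real"
  assumes lin: "linear M" and sym: "\<And>x y. x \<bullet> M y = M x \<bullet> y"
    and pos: "\<And>y. y \<noteq> 0 \<Longrightarrow> y \<bullet> M y > 0"
    and homog: "\<And>c x. c \<ge> 0 \<Longrightarrow> F (c *\<^sub>R x) = c * F x"
    and posF: "\<And>x. x \<noteq> 0 \<Longrightarrow> F x > 0"
    and refl: "\<And>\<nu> x. \<nu> \<noteq> 0 \<Longrightarrow> F (x - (2 * (\<nu> \<bullet> x) / (\<nu> \<bullet> M \<nu>)) *\<^sub>R M \<nu>) = F x"
  shows "ellipsoid {x. F x = 1}"
proof -
  have "inj M"
    using pos by (auto simp: linear_injective_0[OF lin]) (metis inner_zero_right less_irrefl)
  then obtain M' where M': "linear M'" "\<And>x. M' (M x) = x" "\<And>x. M (M' x) = x"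
    using linear_injective_isomorphism[OF lin] by blast
  define g where "g = (\<lambda>x y. x \<bullet> M' y)"
  have gsym: "g x y = g y x" for x y
    using sym[of "M' x" "M' y"] by (simp add: g_def M' inner_commute)
  have gpos: "g x x > 0" if "x \<noteq> 0" for x
  proof -
    have "M' x \<noteq> 0"
      using that M'(3) lin linear_0 by metis
    from pos[OF this] show ?thesis
      by (simp add: g_def M' inner_commute)
  qed
  have bil: "bilinear g"
    unfolding g_def bilinear_def
    by (auto intro!: linearI simp: inner_left_distrib inner_right_distrib linear_add[OF M'(1)] linear_scale[OF M'(1)])
  have eqF: "F x = F y" if "g x x = g y y" for x y
  proof (cases "x = y")
    case False
    \<comment> \<open>Normal covector of the \<open>g\<close>-bisector of \<open>x\<close> and
      \<open>y\<close>; the reflection axis \<open>M \<nu>\<close> is then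
      \<open>x - y\<close>.\<close>
    define \<nu> where "\<nu> = M' (x - y)"
    have "\<nu> \<noteq> 0"
      using False M'(3)[of "x - y"] linear_0[OF lin] by (auto simp: \<nu>_def)
    have M\<nu>: "M \<nu> = x - y" and n: "\<nu> \<bullet> v = g (x - y) v" for v
      using gsym[of v "x - y"] by (simp_all add: \<nu>_def M' g_def inner_commute)
    \<comment> \<open>Equal lengths make the coefficient in the reflection formula equal to 1, so
      \<open>x\<close> is carried to \<open>y\<close>.\<close>
    have "g (x - y) (x - y) = 2 * g (x - y) x"
      using that gsym[of x y]
      by (simp add: bilinear_lsub[OF bil] bilinear_rsub[OF bil])
    moreover have "g (x - y) (x - y) > 0"
      using False by (intro gpos) simp
    ultimately have "x - (2 * (\<nu> \<bullet> x) / (\<nu> \<bullet> M \<nu>)) *\<^sub>R M \<nu> = y"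
      by (simp add: M\<nu> n)
    then show ?thesis
      using refl[OF \<open>\<nu> \<noteq> 0\<close>, of x] by simp
  qed simp
  obtain x0 :: "real^'n" where x0: "x0 \<noteq> 0"
    using axis_eq_0_iff[of _ "1::real"] by (metis zero_neq_one)
  define \<kappa> where "\<kappa> = g x0 x0 / (F x0)\<^sup>2"
  have \<kappa>: "\<kappa> > 0"
    using gpos[OF x0] posF[OF x0] by (simp add: \<kappa>_def)
  have gF: "g x x = \<kappa> * (F x)\<^sup>2" for x
  proof (cases "x = 0")
    case True
    then show ?thesis
      using homog[of 0 x] by (simp add: g_def)
  next
    case False
    \<comment> \<open>Rescales \<open>x\<close> to the \<open>g\<close>-length of the reference
      vector \<open>x0\<close>.\<close>
    define c where "c = sqrt (g x0 x0 / g x x)"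
    have "c > 0" "c\<^sup>2 * g x x = g x0 x0"
      using gpos[OF False] gpos[OF x0] by (simp_all add: c_def)
    then have "F (c *\<^sub>R x) = F x0"
      by (intro eqF) (simp add: bilinear_lmul[OF bil] bilinear_rmul[OF bil] power2_eq_square)
    then have "F x0 = c * F x"
      using homog[of c x] \<open>c > 0\<close> by simp
    then show ?thesis
      using \<open>c\<^sup>2 * g x x = g x0 x0\<close> \<open>c > 0\<close> posF[OF False]
      by (simp add: \<kappa>_def power_mult_distrib field_simps)
  qed
  show ?thesis
    unfolding ellipsoid_def
  proof (intro exI[of _ "\<lambda>v w. g v w / \<kappa>"] conjI allI impI)
    show "bilinear (\<lambda>v w. g v w / \<kappa>)"
      unfolding bilinear_def
      by (intro conjI allI linearI) (simp_all add: add_divide_distrib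
          bilinear_ladd[OF bil] bilinear_radd[OF bil] bilinear_lmul[OF bil] bilinear_rmul[OF bil])
    show "{x. F x = 1} = {v. g v v / \<kappa> = 1}"
    proof -
      have "F x \<ge> 0" for x
        using posF[of x] homog[of 0 x] by (cases "x = 0") auto
      then have "F x = 1 \<longleftrightarrow> (F x)\<^sup>2 = 1" for x
        by (metis abs_of_nonneg abs_square_eq_1)
      then show ?thesis
        using \<kappa> by (simp add: gF)
    qed
  qed (use gsym gpos \<kappa> in auto)
qed

text \<open>The hyperplane determines the axis of a reflection preserving the body: \<open>n\<close>
  must be parallel to \<open>M \<nu>\<close>. This supplies the reflections required by
  \<open>ellipsoid_level_set\<close>.\<close>

lemma ellipsoid_of_reflections:
  fixes F :: "real^'n \<Rightarrow> real"
  assumes K: "compact {x. F x \<le> 1}" "interior {x. F x \<le> 1} \<noteq> {}"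
    and homog: "\<And>c x. c \<ge> 0 \<Longrightarrow> F (c *\<^sub>R x) = c * F x"
    and posF: "\<And>x. x \<noteq> 0 \<Longrightarrow> F x > 0"
    and refl: "\<And>\<nu>. \<nu> \<noteq> 0 \<Longrightarrow> \<exists>n. \<nu> \<bullet> n \<noteq> 0 \<and> (\<forall>x. F (x - (2 * (\<nu> \<bullet> x) / (\<nu> \<bullet> n)) *\<^sub>R n) = F x)"
  shows "ellipsoid {x. F x = 1}"
proof -
  obtain M where M: "linear M" "\<And>x y. x \<bullet> M y = M x \<bullet> y" "\<And>y. y \<noteq> 0 \<Longrightarrow> y \<bullet> M y > 0"
    and inv: "\<And>s z. \<lbrakk>linear s; \<And>x. s (s x) = x; s ` {x. F x \<le> 1} \<subseteq> {x. F x \<le> 1}\<rbrakk>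
        \<Longrightarrow> s (M (adjoint s z)) = M z"
    using exists_invariant_operator[OF K] by blast
  have "F (x - (2 * (\<nu> \<bullet> x) / (\<nu> \<bullet> M \<nu>)) *\<^sub>R M \<nu>) = F x" if "\<nu> \<noteq> 0" for \<nu> x
  proof -
    obtain n where n: "\<nu> \<bullet> n \<noteq> 0" "\<And>x. F (x - (2 * (\<nu> \<bullet> x) / (\<nu> \<bullet> n)) *\<^sub>R n) = F x"
      using refl[OF \<open>\<nu> \<noteq> 0\<close>] by blast
    define s where "s = (\<lambda>x. x - (2 * (\<nu> \<bullet> x) / (\<nu> \<bullet> n)) *\<^sub>R n)"
    have s: "linear s"
      unfolding s_def
      by (auto intro!: linearI simp: inner_right_distrib algebra_simps add_divide_distrib)
    have \<nu>s: "\<nu> \<bullet> s x = - (\<nu> \<bullet> x)" for x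
      using n(1) by (simp add: s_def inner_diff_right)
    have "s (s x) = x" for x
      using \<nu>s[of x] by (simp add: s_def[THEN fun_cong, of "s x"]) (simp add: s_def)
    moreover have "s ` {x. F x \<le> 1} \<subseteq> {x. F x \<le> 1}"
      using n(2) by (auto simp: s_def)
    \<comment> \<open>\<open>s\<close> reverses the covector \<nu>, so the invariance of
      \<open>M\<close>, taken at \<nu>, makes \<open>M \<nu>\<close> an eigenvector of
      \<open>s\<close> for -1, hence a multiple of \<open>n\<close>.\<close>
    moreover have "adjoint s \<nu> = - \<nu>"
      using adjoint_works[OF s] \<nu>s by (intro vector_eq_rdot[THEN iffD1]) (simp add: inner_commute)
    ultimately have "s (M (- \<nu>)) = M \<nu>"
      using inv[OF s, of \<nu>] by simp
    then have "s (M \<nu>) = - M \<nu>"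
      by (metis M(1) add.inverse_inverse linear_neg s)
    then have "2 *\<^sub>R M \<nu> = (2 * (\<nu> \<bullet> M \<nu>) / (\<nu> \<bullet> n)) *\<^sub>R n"
      by (simp add: s_def scaleR_2 algebra_simps eq_neg_iff_add_eq_0)
    then have "(1/2) *\<^sub>R (2 *\<^sub>R M \<nu>) = (1/2) *\<^sub>R ((2 * (\<nu> \<bullet> M \<nu>) / (\<nu> \<bullet> n)) *\<^sub>R n)"
      by (rule arg_cong)
    moreover define a where "a = \<nu> \<bullet> M \<nu>"
    ultimately have M\<nu>: "M \<nu> = (a / (\<nu> \<bullet> n)) *\<^sub>R n"
      by simp
    have "a \<noteq> 0"
      using M(3)[OF that] by (simp add: a_def)
    then have "x - (2 * (\<nu> \<bullet> x) / a) *\<^sub>R M \<nu> = s x"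
      unfolding M\<nu> s_def by simp
    then have "x - (2 * (\<nu> \<bullet> x) / (\<nu> \<bullet> M \<nu>)) *\<^sub>R M \<nu> = s x"
      by (simp only: a_def)
    then show ?thesis
      using n(2) by (simp add: s_def)
  qed
  then show ?thesis
    by (intro ellipsoid_level_set[OF M homog posF])
qed

section \<open>Assembly at a fixed base point\<close>

theorem corollary1p17:
  fixes U :: "(real ^ 'n) set"
    and I :: "real ^ 'n \<Rightarrow> (real ^ 'n) set"
  assumes "open U" and "connected U" and "simply_connected U"
    and "finsler_structure U I"
    and "projective_reflection_law U I"
  shows "riemannian U I"
  unfolding riemannian_def
proof
  fix x assume x: "x \<in> U"
  then have "indicatrix (I x)"
    using assms(4) by (simp add: finsler_structure_def)
  then obtain K where K: "smooth_symmetric_body K" and Ix: "I x = frontier K"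
    by (rule indicatrix_smooth_symmetric_body)
  interpret smooth_symmetric_body K
    by (fact K)
  have body: "{y. minkowski y \<le> 1} = K"
    using body_iff by blast
  have "ellipsoid {y. minkowski y = 1}"
  proof (rule ellipsoid_of_reflections)
    show "compact {y. minkowski y \<le> 1}"
      unfolding body by (rule compact_body)
    show "interior {y. minkowski y \<le> 1} \<noteq> {}"
      unfolding body using zero_interior by blast
    fix \<nu> :: "real ^ 'n"
    assume "\<nu> \<noteq> 0"
    define H where "H = {y. \<nu> \<bullet> y = 0}"
    have "codim_one_subspace H"
      using dim_hyperplane[OF \<open>\<nu> \<noteq> 0\<close>] unfolding codim_one_subspace_def H_def
      by (simp add: subspace_hyperplane)
    from assms(5)[unfolded projective_reflection_law_def, rule_format, OF x this]
    obtain N s where N: "dim N = 1" "H \<inter> N = {0}"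
      and s: "linear s" "\<forall>h\<in>H. s h = h" "\<forall>m\<in>N. s m = - m"
      and refl: "\<forall>u\<in>I x. \<exists>c>0. finsler_reflection (I x) H u = c *\<^sub>R s u"
      by (elim exE conjE) (rule that)
    obtain n where n: "n \<in> N" "n \<noteq> 0"
      using N(1) dim_eq_0[of N] by auto
    then have \<nu>n: "\<nu> \<bullet> n \<noteq> 0"
      using N(2) by (auto simp: H_def)
    have inv: "minkowski (s y) = minkowski y" for y
      using s refl n(1) unfolding Ix H_def
      by (intro minkowski_reflection_invariant[OF \<nu>n]) auto
    \<comment> \<open>Splitting \<open>y\<close> into a vector of \<open>H\<close> and a multiple of
      \<open>n\<close> rewrites the involution given by \<open>H\<close> and \<open>N\<close> in
      terms of the normal \<nu>.\<close>
    have "s y = y - (2 * (\<nu> \<bullet> y) / (\<nu> \<bullet> n)) *\<^sub>R n" for y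
    proof -
      define t where "t = (\<nu> \<bullet> y) / (\<nu> \<bullet> n)"
      have "y - t *\<^sub>R n \<in> H"
        using \<nu>n by (simp add: H_def t_def inner_diff_right)
      then have "s y - t *\<^sub>R s n = y - t *\<^sub>R n"
        using s(2) by (metis linear_diff linear_scale s(1))
      then have "s y = y - t *\<^sub>R n - t *\<^sub>R n"
        using s(3) n(1) by (simp add: eq_diff_eq add.commute)
      then have "s y = y - (2 * t) *\<^sub>R n"
        by (simp only: mult_2 scaleR_add_left diff_diff_eq)
      then show ?thesis
        by (simp add: t_def)
    qed
    then show "\<exists>n. \<nu> \<bullet> n \<noteq> 0 \<and> (\<forall>y. minkowski (y - (2 * (\<nu> \<bullet> y) / (\<nu> \<bullet> n)) *\<^sub>R n) = minkowski y)"
      using inv \<nu>n by metis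
  qed (use minkowski_scale minkowski_pos in auto)
  then show "ellipsoid (I x)"
    by (simp add: Ix frontier_eq)
qed

end
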